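(* For $t,a\in[0,1]$, the map $T_t\otimes\theta_a:\mathcal{M}_4\to\mathcal{M}_4$ is positive and not decomposable if and only if $\frac13<t\le\frac1{2a+1}$ and $a>0$.
   Context: $T_t(X)=(1-t)\mathrm{Tr}(X)\frac{I_2}{2}+tX$ (qubit depolarizing channel) and $\theta_a(X)=(1-a)X+aX^T$ on $\mathcal{M}_2$; $\mathcal{M}_2\otimes\mathcal{M}_2\cong\mathcal{M}_4$. Decomposable means $T+\vartheta\circ S$ with $T,S$ completely positive and $\vartheta$ the transpose. *)

theory Defs
  imports "Jordan_Normal_Form.Matrix"
begin

text \<open>Matrices over the complex numbers: M_n is represented by complex mat with carrier_mat n n.
A linear map on M_n is represented by a function complex mat to complex mat; only its values
on carrier_mat n n matter.\<close>

definition mtrace :: "complex mat \<Rightarrow> complex" where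
  "mtrace X = (\<Sum>i<dim_row X. X $$ (i, i))"

definition psd :: "nat \<Rightarrow> complex mat \<Rightarrow> bool" where
  "psd n A \<longleftrightarrow> A \<in> carrier_mat n n \<and>
     (\<forall>v :: nat \<Rightarrow> complex.
        let q = (\<Sum>i<n. \<Sum>j<n. cnj (v i) * A $$ (i, j) * v j) in Im q = 0 \<and> Re q \<ge> 0)"

definition linear_map_on :: "nat \<Rightarrow> (complex mat \<Rightarrow> complex mat) \<Rightarrow> bool" where
  "linear_map_on n \<Phi> \<longleftrightarrow>
     (\<forall>X \<in> carrier_mat n n. \<Phi> X \<in> carrier_mat n n) \<and>
     (\<forall>X \<in> carrier_mat n n. \<forall>Y \<in> carrier_mat n n. \<Phi> (X + Y) = \<Phi> X + \<Phi> Y) \<and>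
     (\<forall>X \<in> carrier_mat n n. \<forall>c. \<Phi> (c \<cdot>\<^sub>m X) = c \<cdot>\<^sub>m \<Phi> X)"

definition positive_map :: "nat \<Rightarrow> (complex mat \<Rightarrow> complex mat) \<Rightarrow> bool" where
  "positive_map n \<Phi> \<longleftrightarrow> (\<forall>X. psd n X \<longrightarrow> psd n (\<Phi> X))"

definition munit :: "nat \<Rightarrow> nat \<Rightarrow> nat \<Rightarrow> complex mat" where
  "munit n i j = mat n n (\<lambda>(r, s). if r = i \<and> s = j then 1 else 0)"

text \<open>Kronecker product A (x) B, with the convention M_m (x) M_n = M_(m n),
  index (i,k) |-> i*n + k.\<close>
definition kron :: "complex mat \<Rightarrow> complex mat \<Rightarrow> complex mat" where
  "kron A B = mat (dim_row A * dim_row B) (dim_col A * dim_col B)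
     (\<lambda>(r, s). A $$ (r div dim_row B, s div dim_col B) * B $$ (r mod dim_row B, s mod dim_col B))"

text \<open>Tensor product of linear maps Phi on M_m and Psi on M_n, as a map on M_(m n):
  the linear extension of A (x) B |-> Phi A (x) Psi B.\<close>
definition tensor_map :: "nat \<Rightarrow> nat \<Rightarrow> (complex mat \<Rightarrow> complex mat) \<Rightarrow> (complex mat \<Rightarrow> complex mat)
    \<Rightarrow> complex mat \<Rightarrow> complex mat" where
  "tensor_map m n \<Phi> \<Psi> X = mat (m * n) (m * n) (\<lambda>(r, s).
     (\<Sum>i<m. \<Sum>j<m. \<Sum>k<n. \<Sum>l<n.
          X $$ (i * n + k, j * n + l) * kron (\<Phi> (munit m i j)) (\<Psi> (munit n k l)) $$ (r, s)))"

definition completely_positive :: "nat \<Rightarrow> (complex mat \<Rightarrow> complex mat) \<Rightarrow> bool" where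
  "completely_positive n \<Phi> \<longleftrightarrow> linear_map_on n \<Phi> \<and>
     (\<forall>k. positive_map (k * n) (tensor_map k n (\<lambda>X. X) \<Phi>))"

definition decomposable :: "nat \<Rightarrow> (complex mat \<Rightarrow> complex mat) \<Rightarrow> bool" where
  "decomposable n \<Phi> \<longleftrightarrow> (\<exists>T S. completely_positive n T \<and> completely_positive n S \<and>
     (\<forall>X \<in> carrier_mat n n. \<Phi> X = T X + transpose_mat (S X)))"

definition depol :: "real \<Rightarrow> complex mat \<Rightarrow> complex mat" where
  "depol t X = (complex_of_real (1 - t) * mtrace X / 2) \<cdot>\<^sub>m 1\<^sub>m 2 + complex_of_real t \<cdot>\<^sub>m X"

definition theta :: "real \<Rightarrow> complex mat \<Rightarrow> complex mat" where
  "theta a X = complex_of_real (1 - a) \<cdot>\<^sub>m X + complex_of_real a \<cdot>\<^sub>m transpose_mat X"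

end

theory Submission
  imports Defs
begin

text \<open>
  Positivity: it suffices to treat rank one inputs \<open>v v\<^sup>*\<close>. Reading \<open>u\<close> and \<open>v\<close> as 2 x 2 matrices
  \<open>U\<close> and \<open>V\<close>, the output form at \<open>u\<close> is a combination of the squared moduli of the entries (and the
  trace) of \<open>G = cnj U V\<^sup>T\<close> and \<open>B = cnj U (cnj V)\<^sup>T\<close>, plus one term of variable sign,
  \<open>2 Re (b01 cnj b10)\<close>, which is absorbed because \<open>|det B| = |det G|\<close>. The bound on \<open>t\<close> is forced by
  the maximally entangled input tested on the antisymmetric vector.

  Decomposability for \<open>t \<le> 1/3\<close>: \<open>T\<^sub>t\<close> composed with the transpose is then still completely positive.

  Indecomposability for \<open>t > 1/3\<close>, \<open>a > 0\<close>: twirling with \<open>U \<otimes> cnj U\<close> on the first factor and \<open>O \<otimes> O\<close> on the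
  second one leaves a linear program for a witness with positive partial transpose. Its solution is
  \<open>3 p \<otimes> m + (1 - p) \<otimes> (2 s + m)\<close>, with \<open>p\<close> the maximally entangled projection, \<open>m\<close> the antisymmetric one,
  and \<open>s\<close> the symmetric projection minus the maximally entangled one; its partial transpose is
  \<open>S \<otimes> (s + 2 m) + 3 m \<otimes> (p + m)\<close>, \<open>S\<close> the symmetric projection. It pairs to a positive
  multiple of \<open>a (1 - 3 t)\<close> with the Choi matrix.
\<close>

section \<open>Positive semidefinite matrices as sums of rank one matrices\<close>

text \<open>With two separate arguments, polarization and completing the square become available.
  The first argument is the conjugate-linear one, as in \<open>psd\<close>.\<close>

definition sesq :: "nat \<Rightarrow> complex mat \<Rightarrow> (nat \<Rightarrow> complex) \<Rightarrow> (nat \<Rightarrow> complex) \<Rightarrow> complex" where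
  "sesq n A x y = (\<Sum>i<n. \<Sum>j<n. cnj (x i) * A $$ (i, j) * y j)"

definition outer :: "nat \<Rightarrow> (nat \<Rightarrow> complex) \<Rightarrow> complex mat" where
  "outer n v = mat n n (\<lambda>(i, j). v i * cnj (v j))"

lemma psd_iff_sesq:
  "psd n A \<longleftrightarrow> A \<in> carrier_mat n n \<and> (\<forall>v. Im (sesq n A v v) = 0 \<and> Re (sesq n A v v) \<ge> 0)"
  by (simp add: psd_def sesq_def Let_def)

lemma sesq_combine_right:
  "sesq n A x (\<lambda>i. y i + c * z i) = sesq n A x y + c * sesq n A x z"
  by (simp add: sesq_def algebra_simps sum.distrib sum_distrib_left)

lemma sesq_combine_left:
  "sesq n A (\<lambda>i. x i + c * y i) z = sesq n A x z + cnj c * sesq n A y z"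
  by (simp add: sesq_def algebra_simps sum.distrib sum_distrib_left)

lemma sesq_add:
  assumes "A \<in> carrier_mat n n" "B \<in> carrier_mat n n"
  shows "sesq n (A + B) x y = sesq n A x y + sesq n B x y"
  using assms by (simp add: sesq_def algebra_simps sum.distrib)

lemma sesq_outer: "sesq n (outer n v) x x = of_real ((cmod (\<Sum>i<n. cnj (v i) * x i))\<^sup>2)"
proof -
  have "sesq n (outer n v) x x = (\<Sum>i<n. \<Sum>j<n. (cnj (x i) * v i) * (cnj (v j) * x j))"
    by (simp add: sesq_def outer_def algebra_simps)
  also have "\<dots> = cnj (\<Sum>i<n. cnj (v i) * x i) * (\<Sum>i<n. cnj (v i) * x i)"
    by (simp add: sum_product mult.commute)
  finally show ?thesis
    by (metis complex_norm_square mult.commute)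
qed

text \<open>Polarization: the form is real on the diagonal, and evaluating it at
  \<open>x + c y\<close> with \<open>c = 1\<close> and \<open>c = \<i>\<close> gives the imaginary
  and the real part of the claim.\<close>

lemma sesq_hermitian:
  assumes "psd n A"
  shows "sesq n A y x = cnj (sesq n A x y)"
proof -
  have e: "sesq n A (\<lambda>i. x i + c * y i) (\<lambda>i. x i + c * y i)
    = sesq n A x x + c * sesq n A x y + cnj c * sesq n A y x + c * cnj c * sesq n A y y" for c
    by (simp add: sesq_combine_right sesq_combine_left algebra_simps)
  have im: "Im (sesq n A z z) = 0" for z
    using assms by (simp add: psd_iff_sesq)
  have "Im (sesq n A x y) + Im (sesq n A y x) = 0"
    using im[of "\<lambda>i. x i + 1 * y i"] unfolding e by (simp add: im)
  moreover have "Re (sesq n A x y) - Re (sesq n A y x) = 0"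
    using im[of "\<lambda>i. x i + \<i> * y i"] unfolding e by (simp add: im)
  ultimately show ?thesis
    by (simp add: complex_eq_iff)
qed

lemma sesq_delta_left:
  assumes "k < n"
  shows "sesq n A (\<lambda>i. if i = k then 1 else 0) y = (\<Sum>j<n. A $$ (k, j) * y j)"
proof -
  have "sesq n A (\<lambda>i. if i = k then 1 else 0) y
      = (\<Sum>i<n. if i = k then (\<Sum>j<n. A $$ (k, j) * y j) else 0)"
    unfolding sesq_def by (rule sum.cong) auto
  thus ?thesis using assms by simp
qed

lemma sesq_delta:
  assumes "k < n" "l < n"
  shows "sesq n A (\<lambda>i. if i = k then 1 else 0) (\<lambda>i. if i = l then 1 else 0) = A $$ (k, l)"
  using assms by (simp add: sesq_delta_left if_distrib cong: if_cong)

lemma psd_hermitian_entry: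
  assumes "psd n A" "i < n" "j < n"
  shows "A $$ (j, i) = cnj (A $$ (i, j))"
  using sesq_hermitian[OF assms(1), of "\<lambda>k. if k = j then 1 else 0" "\<lambda>k. if k = i then 1 else 0"]
    assms by (simp add: sesq_delta)

lemma psd_diag:
  assumes "psd n A" "k < n"
  shows "A $$ (k, k) = of_real (Re (A $$ (k, k)))" "Re (A $$ (k, k)) \<ge> 0"
  using assms sesq_delta[of k n k A] unfolding psd_iff_sesq
  by (metis complex_is_Real_iff of_real_Re)+

text \<open>Otherwise a long step from the l-th basis vector along the k-th one makes the form
  negative: the cross terms are linear in the step, and the quadratic term that could compensate
  them has coefficient zero.\<close>

lemma psd_zero_diag:
  assumes "psd n A" "k < n" "l < n" "A $$ (k, k) = 0"
  shows "A $$ (k, l) = 0"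
proof (rule ccontr)
  define e where "e m = (\<lambda>i::nat. if i = m then 1 else 0 :: complex)" for m
  define z where "z = A $$ (k, l)"
  define d where "d = Re (A $$ (l, l))"
  assume "A $$ (k, l) \<noteq> 0"
  hence pos: "(cmod z)\<^sup>2 > 0" by (simp add: z_def)
  have d: "d \<ge> 0" "A $$ (l, l) = of_real d"
    using psd_diag[OF assms(1,3)] by (auto simp: d_def)
  \<comment> \<open>This length makes the cross terms add up to \<open>-2 (d + 1)\<close>, which
    outweighs the diagonal contribution \<open>d\<close>.\<close>
  define r where "r = (d + 1) / (cmod z)\<^sup>2"
  define c where "c = - of_real r * z"
  have "sesq n A (\<lambda>i. e l i + c * e k i) (\<lambda>i. e l i + c * e k i)
      = A $$ (l, l) + c * A $$ (l, k) + cnj c * A $$ (k, l) + c * cnj c * A $$ (k, k)"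
    using assms by (simp add: sesq_combine_right sesq_combine_left e_def sesq_delta algebra_simps)
  also have "\<dots> = of_real d - 2 * of_real r * (z * cnj z)"
    using assms(4) psd_hermitian_entry[OF assms(1,2,3)] d by (simp add: c_def z_def)
  also have "\<dots> = of_real (d - 2 * r * (cmod z)\<^sup>2)"
    by (simp add: complex_norm_square[symmetric])
  also have "r * (cmod z)\<^sup>2 = d + 1"
    using pos by (simp add: r_def)
  hence "d - 2 * r * (cmod z)\<^sup>2 = - d - 2" by simp
  finally have "Re (sesq n A (\<lambda>i. e l i + c * e k i) (\<lambda>i. e l i + c * e k i)) < 0"
    using d by simp
  with assms(1) show False by (meson psd_iff_sesq not_less)
qed

text \<open>Cholesky elimination: the Schur complement with respect to a nonzero diagonal entry splits off
  a rank one matrix and annihilates one more row and column.\<close>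
lemma psd_induct [consumes 1, case_names zero rank_one]:
  assumes "psd n A" and zero: "P (0\<^sub>m n n)"
    and step: "\<And>v B. psd n B \<Longrightarrow> P B \<Longrightarrow> P (outer n v + B)"
  shows "P A"
proof -
  \<comment> \<open>Here \<open>k\<close> bounds the number of leading rows that may be nonzero: the
    condition is void at \<open>k = n\<close> and forces the zero matrix at
    \<open>k = 0\<close>.\<close>
  have "P A" if "k \<le> n" "psd n A" "\<And>i j. i < n \<Longrightarrow> j < n \<Longrightarrow> k \<le> i \<Longrightarrow> A $$ (i, j) = 0" for k A
    using that
  proof (induction k arbitrary: A)
    case 0
    then have "A = 0\<^sub>m n n"
      by (intro eq_matI) (auto simp: psd_def)
    with zero show ?case by simp
  next
    case (Suc k)
    have k: "k < n" using Suc.prems by simp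
    have car: "A \<in> carrier_mat n n" using Suc.prems by (simp add: psd_def)
    show ?case
    proof (cases "A $$ (k, k) = 0")
      case True
      have "A $$ (i, j) = 0" if "i < n" "j < n" "k \<le> i" for i j
        using that Suc.prems(3)[of i j] psd_zero_diag[OF Suc.prems(2) k _ True, of j]
        by (cases "i = k") auto
      with Suc k show ?thesis by simp
    next
      case False
      define d where "d = Re (A $$ (k, k))"
      have dk: "A $$ (k, k) = of_real d" "d \<ge> 0"
        using psd_diag[OF Suc.prems(2) k] by (auto simp: d_def)
      have d: "d > 0" using False dk by (cases "d = 0") auto
      define e where "e = (\<lambda>i::nat. if i = k then 1 else 0 :: complex)"
      define v where "v = (\<lambda>i. A $$ (i, k) / of_real (sqrt d))"
      define B where "B = A - outer n v"
      have sq: "of_real (sqrt d) * of_real (sqrt d) = (of_real d :: complex)"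
        using d by (metis of_real_mult real_sqrt_mult_self abs_of_pos)
      have oc: "outer n v \<in> carrier_mat n n" by (simp add: outer_def)
      have A: "A = outer n v + B"
        using car by (intro eq_matI) (auto simp: B_def outer_def)
      have Bc: "B \<in> carrier_mat n n" using oc by (auto simp: B_def outer_def)
      \<comment> \<open>Completing the square: the form of \<open>B\<close> at \<open>x\<close> is
        the form of \<open>A\<close> at \<open>x\<close> minus its \<open>A\<close>-orthogonal
        projection onto \<open>e\<close>, so \<open>B\<close> inherits nonnegativity.\<close>
      have "sesq n B x x = sesq n A (\<lambda>i. x i + - (sesq n A e x / of_real d) * e i)
          (\<lambda>i. x i + - (sesq n A e x / of_real d) * e i)" for x
      proof -
        have s: "sesq n A e x = of_real (sqrt d) * (\<Sum>i<n. cnj (v i) * x i)"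
          unfolding e_def sesq_delta_left[OF k] sum_distrib_left
          using psd_hermitian_entry[OF Suc.prems(2) _ k] d
          by (intro sum.cong) (auto simp: v_def)
        have "sesq n B x x = sesq n A x x - of_real ((cmod (\<Sum>i<n. cnj (v i) * x i))\<^sup>2)"
          using sesq_add[OF oc Bc, of x x] sesq_outer[of n v x] by (simp add: A[symmetric])
        also have "(cmod (\<Sum>i<n. cnj (v i) * x i))\<^sup>2 = (cmod (sesq n A e x))\<^sup>2 / d"
          using d by (simp add: s norm_mult power_mult_distrib)
        also have "sesq n A x x - of_real ((cmod (sesq n A e x))\<^sup>2 / d)
          = sesq n A x x - sesq n A e x * cnj (sesq n A e x) / of_real d"
          by (simp only: of_real_divide complex_norm_square)
        also have "\<dots> = sesq n A (\<lambda>i. x i + - (sesq n A e x / of_real d) * e i)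
          (\<lambda>i. x i + - (sesq n A e x / of_real d) * e i)"
        proof -
          have "sesq n A e e = of_real d" using k dk by (simp add: e_def sesq_delta)
          then show ?thesis
            unfolding sesq_combine_right sesq_combine_left sesq_hermitian[OF Suc.prems(2), of x e]
            using d by (simp add: field_simps)
        qed
        finally show ?thesis .
      qed
      then have psdB: "psd n B"
        using Suc.prems(2) Bc by (simp add: psd_iff_sesq)
      \<comment> \<open>Row \<open>k\<close> is cancelled by the choice of \<open>v\<close>. For
        \<open>i > k\<close> the entry \<open>A $$ (i, k)\<close> is already zero, hence
        \<open>v i = 0\<close> and the rows cleared before stay clear.\<close>
      have "B $$ (i, j) = 0" if ij: "i < n" "j < n" "k \<le> i" for i j
      proof (cases "i = k")
        case True
        have "B $$ (k, j) = A $$ (k, j) - A $$ (k, k) * cnj (A $$ (j, k)) / of_real d"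
          using ij k car sq d by (simp add: B_def outer_def v_def field_simps)
        also have "\<dots> = 0"
          using d dk psd_hermitian_entry[OF Suc.prems(2) ij(2) k] by simp
        finally show ?thesis using True by simp
      next
        case False
        then show ?thesis
          using ij k car Suc.prems(3)[of i j] Suc.prems(3)[of i k]
          by (simp add: B_def outer_def v_def)
      qed
      then have "P B" using Suc psdB by simp
      with step[OF psdB] A show ?thesis by simp
    qed
  qed
  from this[of n A] assms(1) show ?thesis by simp
qed

lemma psd_add:
  assumes "psd n A" "psd n B"
  shows "psd n (A + B)"
  using assms by (simp add: psd_iff_sesq sesq_add)

text \<open>Every positive semidefinite matrix is a finite sum of matrices \<open>outer n v\<close>,
  and positivity is preserved by sums.\<close>

lemma positive_map_rank_oneI:
  assumes lin: "linear_map_on n \<Phi>" and rank1: "\<And>v. psd n (\<Phi> (outer n v))"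
  shows "positive_map n \<Phi>"
  unfolding positive_map_def
proof (intro allI impI)
  fix X assume "psd n X"
  then show "psd n (\<Phi> X)"
  proof (induction rule: psd_induct)
    case zero
    have "\<Phi> (0 \<cdot>\<^sub>m 0\<^sub>m n n) = 0 \<cdot>\<^sub>m \<Phi> (0\<^sub>m n n)" "\<Phi> (0\<^sub>m n n) \<in> carrier_mat n n"
      using lin unfolding linear_map_on_def by (metis zero_carrier_mat)+
    moreover have "0 \<cdot>\<^sub>m M = 0\<^sub>m n n" if "M \<in> carrier_mat n n" for M :: "complex mat"
      using that by (intro eq_matI) auto
    ultimately have "\<Phi> (0\<^sub>m n n) = 0\<^sub>m n n"
      by simp
    then show ?case by (simp add: psd_def)
  next
    case (rank_one v B)
    then have "\<Phi> (outer n v + B) = \<Phi> (outer n v) + \<Phi> B"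
      using lin unfolding linear_map_on_def by (simp add: outer_def psd_def)
    with rank_one rank1 psd_add show ?case by simp
  qed
qed


section \<open>The tensor product map\<close>

lemma mult_add_less:
  fixes i k n p :: nat
  assumes "i < k" "p < n"
  shows "i * n + p < k * n"
proof -
  have "i * n + p < Suc i * n" using assms by simp
  also have "\<dots> \<le> k * n" using assms by (intro mult_le_mono1) simp
  finally show ?thesis .
qed

text \<open>The factors enter only through their values on matrix units, so each output entry is a
  fixed linear combination of the entries of the argument.\<close>

lemma tensor_map_linear: "linear_map_on (m * n) (tensor_map m n \<Phi> \<Psi>)"
  unfolding linear_map_on_def
  by (auto intro!: eq_matI sum.cong simp: tensor_map_def mult_add_less sum.distrib[symmetric]
      sum_distrib_left distrib_right mult.assoc)

lemma sum4: "(\<Sum>i<4. f i) = f 0 + f 1 + f 2 + f 3" for f :: "nat \<Rightarrow> 'a :: comm_monoid_add"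
  by (simp add: eval_nat_numeral ac_simps)

lemma sum2: "(\<Sum>i<2. f i) = f 0 + f 1" for f :: "nat \<Rightarrow> 'a :: comm_monoid_add"
  by (simp add: eval_nat_numeral ac_simps)

section \<open>Matrix units and the entries of T_t \<otimes> \<theta>_a\<close>

lemma munit_entry:
  assumes "p < n" "q < n"
  shows "munit n i j $$ (p, q) = (if p = i \<and> q = j then 1 else 0)"
  using assms by (simp add: munit_def)

lemma munit_carrier [simp]: "munit n i j \<in> carrier_mat n n"
  by (simp add: munit_def)

lemma munit_dim [simp]: "dim_row (munit n i j) = n" "dim_col (munit n i j) = n"
  by (simp_all add: munit_def)

lemma mtrace_munit:
  assumes "i < n"
  shows "mtrace (munit n i j) = (if i = j then 1 else 0)"
proof -
  have "mtrace (munit n i j) = (\<Sum>k<n. if k = i then (if i = j then 1 else 0) else 0)"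
    unfolding mtrace_def by (intro sum.cong) (auto simp: munit_entry)
  then show ?thesis using assms by simp
qed

lemma depol_munit_entry:
  assumes "p < 2" "q < 2" "i < 2" "j < 2"
  shows "depol t (munit 2 i j) $$ (p, q) =
    (if i = j \<and> p = q then of_real ((1 - t) / 2) else 0) + (if p = i \<and> q = j then of_real t else 0)"
proof -
  have "depol t (munit 2 i j) $$ (p, q)
      = of_real ((1 - t) / 2) * (if i = j \<and> p = q then 1 else 0)
        + of_real t * (if p = i \<and> q = j then 1 else 0)"
    unfolding depol_def mtrace_munit[OF assms(3)] using assms by (simp add: munit_entry)
  then show ?thesis
    by simp
qed

lemma theta_munit_entry:
  assumes "p < 2" "q < 2" "i < 2" "j < 2"
  shows "theta a (munit 2 i j) $$ (p, q) =
    (if p = i \<and> q = j then of_real (1 - a) else 0) + (if p = j \<and> q = i then of_real a else 0)"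
proof -
  have delta: "x * (if P then 1 else 0) = (if P then x else 0)" for x :: complex and P
    by simp
  have "theta a (munit 2 i j) $$ (p, q)
      = of_real (1 - a) * munit 2 i j $$ (p, q) + of_real a * munit 2 i j $$ (q, p)"
    unfolding theta_def using assms by simp
  then show ?thesis
    unfolding munit_entry[OF assms(1,2)] munit_entry[OF assms(2,1)] delta
      conj_commute[of "q = i" "p = j"] .
qed

lemma depol_dim: "dim_row (depol t (munit 2 i j)) = 2" "dim_col (depol t (munit 2 i j)) = 2"
  by (simp_all add: depol_def)

lemma theta_dim: "dim_row (theta a (munit 2 i j)) = 2" "dim_col (theta a (munit 2 i j)) = 2"
  by (simp_all add: theta_def)

text \<open>This expands T_t(H) over matrix units. \<open>H\<close> is a function of the indices so
  that a whole inner sum over the other tensor factor can be substituted for it.\<close>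

lemma depol_munit_sum:
  assumes "p < 2" "q < 2"
  shows "(\<Sum>i<2. \<Sum>j<2. H i j * depol t (munit 2 i j) $$ (p, q))
    = (if p = q then of_real ((1 - t) / 2) * (\<Sum>m<2. H m m) else 0) + of_real t * H p q"
proof -
  define c where "c = complex_of_real ((1 - t) / 2)"
  have e: "depol t (munit 2 i j) $$ (p, q)
      = (if i = j \<and> p = q then c else 0) + (if p = i \<and> q = j then of_real t else 0)"
    if "i < 2" "j < 2" for i j
    unfolding c_def using assms that by (rule depol_munit_entry)
  have one_less_two: "(1 :: nat) < 2" by simp
  have "p = 0 \<or> p = 1" "q = 0 \<or> q = 1" using assms by auto
  then show ?thesis
    unfolding sum2 c_def[symmetric] e[OF pos2 pos2] e[OF pos2 one_less_two] e[OF one_less_two pos2]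
      e[OF one_less_two one_less_two]
    by (elim disjE) (simp_all add: algebra_simps)
qed

lemma theta_munit_sum:
  assumes "p < 2" "q < 2"
  shows "(\<Sum>k<2. \<Sum>l<2. H k l * theta a (munit 2 k l) $$ (p, q))
    = of_real (1 - a) * H p q + of_real a * H q p"
proof -
  define b where "b = complex_of_real (1 - a)"
  have e: "theta a (munit 2 k l) $$ (p, q)
      = (if p = k \<and> q = l then b else 0) + (if p = l \<and> q = k then of_real a else 0)"
    if "k < 2" "l < 2" for k l
    unfolding b_def using assms that by (rule theta_munit_entry)
  have one_less_two: "(1 :: nat) < 2" by simp
  have "p = 0 \<or> p = 1" "q = 0 \<or> q = 1" using assms by auto
  then show ?thesis
    unfolding sum2 b_def[symmetric] e[OF pos2 pos2] e[OF pos2 one_less_two] e[OF one_less_two pos2]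
      e[OF one_less_two one_less_two]
    by (elim disjE) (simp_all add: algebra_simps)
qed

text \<open>The fourfold sum is evaluated one factor at a time: \<theta>_a acts inside the 2 x 2
  blocks, T_t on the block indices. \<open>div 2\<close> reads off the first factor and
  \<open>mod 2\<close> the second.\<close>

lemma tensor_depol_theta_entry:
  assumes "r < 4" "s < 4"
  shows "tensor_map 2 2 (depol t) (theta a) X $$ (r, s) =
    (if r div 2 = s div 2
     then of_real ((1 - t) / 2) * (\<Sum>m<2. of_real (1 - a) * X $$ (m * 2 + r mod 2, m * 2 + s mod 2)
            + of_real a * X $$ (m * 2 + s mod 2, m * 2 + r mod 2))
     else 0)
    + of_real t * (of_real (1 - a) * X $$ (r div 2 * 2 + r mod 2, s div 2 * 2 + s mod 2)
            + of_real a * X $$ (r div 2 * 2 + s mod 2, s div 2 * 2 + r mod 2))"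
proof -
  have rs: "r div 2 < 2" "s div 2 < 2" "r mod 2 < 2" "s mod 2 < 2" using assms by auto
  have "tensor_map 2 2 (depol t) (theta a) X $$ (r, s) =
     (\<Sum>i<2. \<Sum>j<2. \<Sum>k<2. \<Sum>l<2. X $$ (i * 2 + k, j * 2 + l) *
       (depol t (munit 2 i j) $$ (r div 2, s div 2) * theta a (munit 2 k l) $$ (r mod 2, s mod 2)))"
    using assms unfolding tensor_map_def by (simp add: kron_def depol_dim theta_dim)
  also have "\<dots> = (\<Sum>i<2. \<Sum>j<2. (\<Sum>k<2. \<Sum>l<2. X $$ (i * 2 + k, j * 2 + l) *
       theta a (munit 2 k l) $$ (r mod 2, s mod 2)) * depol t (munit 2 i j) $$ (r div 2, s div 2))"
    unfolding sum_distrib_right by (simp only: mult_ac)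
  finally show ?thesis
    unfolding theta_munit_sum[OF rs(3,4)] depol_munit_sum[OF rs(1,2)] .
qed

subsection \<open>Positivity\<close>

text \<open>The trace part of T_t produces the squared Frobenius norms of \<open>G\<close> and
  \<open>B\<close>; its identity part produces the squared modulus of the trace of \<open>G\<close>
  and, after the transpose in the second factor, the trace of \<open>B\<close> times its entrywise
  conjugate.\<close>

lemma sesq_tensor_rank_one:
  fixes u v :: "nat \<Rightarrow> complex"
  defines "G \<equiv> \<lambda>i m. cnj (u (2 * i)) * v (2 * m) + cnj (u (2 * i + 1)) * v (2 * m + 1)"
    and "B \<equiv> \<lambda>i m. cnj (u (2 * i)) * cnj (v (2 * m)) + cnj (u (2 * i + 1)) * cnj (v (2 * m + 1))"
  shows "sesq 4 (tensor_map 2 2 (depol t) (theta a) (outer 4 v)) u u =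
    of_real ((1 - t) / 2) * (of_real (1 - a) * (\<Sum>i<2. \<Sum>m<2. G i m * cnj (G i m))
        + of_real a * (\<Sum>i<2. \<Sum>m<2. B i m * cnj (B i m)))
    + of_real t * (of_real (1 - a) * ((G 0 0 + G 1 1) * cnj (G 0 0 + G 1 1))
        + of_real a * (\<Sum>i<2. \<Sum>m<2. B i m * cnj (B m i)))"
proof -
  define c where "c = complex_of_real ((1 - t) / 2)"
  define \<alpha> where "\<alpha> = complex_of_real a"
  define \<beta> where "\<beta> = complex_of_real (1 - a)"
  define \<tau> where "\<tau> = complex_of_real t"
  show ?thesis
    unfolding c_def[symmetric] \<alpha>_def[symmetric] \<beta>_def[symmetric] \<tau>_def[symmetric]
    unfolding sesq_def G_def B_def sum4
    by (simp add: tensor_depol_theta_entry c_def[symmetric] \<alpha>_def[symmetric] \<beta>_def[symmetric]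
        \<tau>_def[symmetric] sum2 outer_def del: of_real_diff of_real_divide) (simp add: algebra_simps)
qed

text \<open>This is the scalar inequality behind positivity. The only term of variable sign is at
  least \<open>- y\<close> with \<open>y = 2 * cmod (b01 * b10)\<close>, and \<open>y\<close> has
  two upper bounds: \<open>r\<close> by the mean inequality, and \<open>s + g\<close> by the
  determinant identity.\<close>

lemma tensor_form_nonneg:
  fixes g00 g01 g10 g11 b00 b01 b10 b11 :: complex
  assumes "0 \<le> t" "0 \<le> a" "a \<le> 1" "t * a \<le> (1 - t) / 2"
    and det: "cmod (b00 * b11 - b01 * b10) = cmod (g00 * g11 - g01 * g10)"
  shows "(1 - t) / 2 * ((1 - a) * ((cmod g00)\<^sup>2 + (cmod g01)\<^sup>2 + (cmod g10)\<^sup>2 + (cmod g11)\<^sup>2)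
       + a * ((cmod b00)\<^sup>2 + (cmod b01)\<^sup>2 + (cmod b10)\<^sup>2 + (cmod b11)\<^sup>2))
     + t * ((1 - a) * (cmod (g00 + g11))\<^sup>2
       + a * ((cmod b00)\<^sup>2 + (cmod b11)\<^sup>2 + 2 * Re (b01 * cnj b10))) \<ge> 0"
proof -
  have amgm: "2 * cmod (x * y) \<le> (cmod x)\<^sup>2 + (cmod y)\<^sup>2" for x y
    using sum_squares_bound[of "cmod x" "cmod y"] by (simp add: norm_mult)
  define g where "g = (cmod g00)\<^sup>2 + (cmod g01)\<^sup>2 + (cmod g10)\<^sup>2 + (cmod g11)\<^sup>2"
  define s where "s = (cmod b00)\<^sup>2 + (cmod b11)\<^sup>2"
  define r where "r = (cmod b01)\<^sup>2 + (cmod b10)\<^sup>2"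
  define y where "y = 2 * cmod (b01 * b10)"
  have yr: "y \<le> r" using amgm by (simp add: y_def r_def)
  \<comment> \<open>The product \<open>b01 * b10\<close> differs from \<open>b00 * b11\<close> by
    the determinant, whose modulus is controlled by the entries of the other matrix.\<close>
  have "cmod (b01 * b10) \<le> cmod (b00 * b11) + cmod (b00 * b11 - b01 * b10)"
    by (metis add.commute norm_minus_commute norm_triangle_sub)
  moreover have "cmod (g00 * g11 - g01 * g10) \<le> cmod (g00 * g11) + cmod (g01 * g10)"
    by (rule norm_triangle_ineq4)
  ultimately have ysg: "y \<le> s + g"
    using amgm[of b00 b11] amgm[of g00 g11] amgm[of g01 g10] det unfolding y_def s_def g_def by linarith
  have ry: "2 * Re (b01 * cnj b10) \<ge> - y"
    using abs_Re_le_cmod[of "b01 * cnj b10"] unfolding y_def by (simp add: norm_mult abs_le_iff)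
  have nn: "0 \<le> g" "0 \<le> s" "0 \<le> r" by (simp_all add: g_def s_def r_def)
  \<comment> \<open>This is what remains after \<open>(1 - t) / 2\<close> is lowered to
    \<open>t * a\<close> and the trace term is dropped. The bound \<open>y \<le> s + g\<close> is
    used with weight \<open>1 - a\<close>, the bound \<open>y \<le> r\<close> with weight
    \<open>a\<close>.\<close>
  have "0 \<le> (t * a) * ((1 - a) * (s + g - y) + a * (s + r) + a * (s - y))"
  proof -
    have "0 \<le> (1 - a) * (s + g - y) + a * (2 * s + (r - y))"
      using assms nn yr ysg by (intro add_nonneg_nonneg mult_nonneg_nonneg) auto
    then show ?thesis using assms by (intro mult_nonneg_nonneg) (auto simp: algebra_simps)
  qed
  also have "\<dots> = (t * a) * ((1 - a) * g + a * (s + r)) + t * (a * (s - y))"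
    by (simp add: algebra_simps)
  also have "\<dots> \<le> (1 - t) / 2 * ((1 - a) * g + a * (s + r))
      + t * ((1 - a) * (cmod (g00 + g11))\<^sup>2 + a * (s + 2 * Re (b01 * cnj b10)))"
  proof (rule add_mono)
    show "(t * a) * ((1 - a) * g + a * (s + r)) \<le> (1 - t) / 2 * ((1 - a) * g + a * (s + r))"
      using assms nn by (intro mult_right_mono add_nonneg_nonneg mult_nonneg_nonneg) auto
    have "a * (s - y) \<le> a * (s + 2 * Re (b01 * cnj b10))"
      using ry assms by (intro mult_left_mono) auto
    moreover have "0 \<le> (1 - a) * (cmod (g00 + g11))\<^sup>2"
      using assms by simp
    ultimately show "t * (a * (s - y))
        \<le> t * ((1 - a) * (cmod (g00 + g11))\<^sup>2 + a * (s + 2 * Re (b01 * cnj b10)))"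
      using assms by (intro mult_left_mono) linarith+
  qed
  finally show ?thesis
    by (simp add: g_def s_def r_def algebra_simps)
qed

lemma tensor_depol_theta_positive:
  assumes "0 \<le> t" "0 \<le> a" "a \<le> 1" "t * a \<le> (1 - t) / 2"
  shows "positive_map 4 (tensor_map 2 2 (depol t) (theta a))"
proof (rule positive_map_rank_oneI)
  show "linear_map_on 4 (tensor_map 2 2 (depol t) (theta a))"
    using tensor_map_linear[of 2 2] by simp
next
  fix v :: "nat \<Rightarrow> complex"
  let ?\<Phi> = "tensor_map 2 2 (depol t) (theta a)"
  have "Im (sesq 4 (?\<Phi> (outer 4 v)) u u) = 0 \<and> Re (sesq 4 (?\<Phi> (outer 4 v)) u u) \<ge> 0" for u
  proof -
    define G where "G i m = cnj (u (2 * i)) * v (2 * m) + cnj (u (2 * i + 1)) * v (2 * m + 1)"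
      for i m :: nat
    define B where "B i m = cnj (u (2 * i)) * cnj (v (2 * m)) + cnj (u (2 * i + 1)) * cnj (v (2 * m + 1))"
      for i m :: nat
    define R where "R = (1 - t) / 2 * ((1 - a) * ((cmod (G 0 0))\<^sup>2 + (cmod (G 0 1))\<^sup>2 + (cmod (G 1 0))\<^sup>2 + (cmod (G 1 1))\<^sup>2)
       + a * ((cmod (B 0 0))\<^sup>2 + (cmod (B 0 1))\<^sup>2 + (cmod (B 1 0))\<^sup>2 + (cmod (B 1 1))\<^sup>2))
     + t * ((1 - a) * (cmod (G 0 0 + G 1 1))\<^sup>2
       + a * ((cmod (B 0 0))\<^sup>2 + (cmod (B 1 1))\<^sup>2 + 2 * Re (B 0 1 * cnj (B 1 0))))"
    have cross: "x * cnj y + y * cnj x = of_real (2 * Re (x * cnj y))" for x y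
      by (simp add: complex_eq_iff)
    have "sesq 4 (?\<Phi> (outer 4 v)) u u = of_real ((1 - t) / 2) * (of_real (1 - a) * (\<Sum>i<2. \<Sum>m<2. G i m * cnj (G i m))
        + of_real a * (\<Sum>i<2. \<Sum>m<2. B i m * cnj (B i m)))
      + of_real t * (of_real (1 - a) * ((G 0 0 + G 1 1) * cnj (G 0 0 + G 1 1))
        + of_real a * (B 0 0 * cnj (B 0 0) + B 1 1 * cnj (B 1 1) + (B 0 1 * cnj (B 1 0) + B 1 0 * cnj (B 0 1))))"
      unfolding sesq_tensor_rank_one G_def[symmetric] B_def[symmetric] by (simp add: sum2 ac_simps)
    also have "\<dots> = of_real R"
      unfolding R_def sum2 cross complex_norm_square[symmetric] by (simp add: ac_simps)
    finally have *: "sesq 4 (?\<Phi> (outer 4 v)) u u = of_real R" .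
    \<comment> \<open>Multiplicativity of the determinant: both determinants are products of det U
      and det V up to conjugation of the factors, hence have equal modulus.\<close>
    have "G 0 0 * G 1 1 - G 0 1 * G 1 0
        = cnj (u 0 * u 3 - u 1 * u 2) * (v 0 * v 3 - v 1 * v 2)"
      by (simp add: G_def algebra_simps eval_nat_numeral)
    moreover have "B 0 0 * B 1 1 - B 0 1 * B 1 0
        = cnj (u 0 * u 3 - u 1 * u 2) * cnj (v 0 * v 3 - v 1 * v 2)"
      by (simp add: B_def algebra_simps eval_nat_numeral)
    ultimately have "cmod (B 0 0 * B 1 1 - B 0 1 * B 1 0) = cmod (G 0 0 * G 1 1 - G 0 1 * G 1 0)"
      by (simp only: norm_mult complex_mod_cnj)
    then have "R \<ge> 0"
      unfolding R_def by (rule tensor_form_nonneg[OF assms])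
    with * show ?thesis by simp
  qed
  then show "psd 4 (?\<Phi> (outer 4 v))"
    by (simp add: psd_iff_sesq tensor_map_def)
qed

text \<open>For the maximally entangled \<open>v\<close> and the antisymmetric \<open>u\<close>, V
  is the identity and U is antisymmetric. Then \<open>G\<close> and \<open>B\<close> both equal U:
  the trace term vanishes, while the transposed term attains its negative extreme.\<close>

lemma positive_imp_bound:
  assumes "positive_map 4 (tensor_map 2 2 (depol t) (theta a))"
  shows "t * a \<le> (1 - t) / 2"
proof -
  define v :: "nat \<Rightarrow> complex" where "v = (\<lambda>i. if i = 0 \<or> i = 3 then 1 else 0)"
  define u :: "nat \<Rightarrow> complex" where "u = (\<lambda>i. if i = 1 then 1 else if i = 2 then -1 else 0)"
  have "psd 4 (outer 4 v)"
    by (simp add: psd_iff_sesq sesq_outer) (simp add: outer_def)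
  then have "Re (sesq 4 (tensor_map 2 2 (depol t) (theta a) (outer 4 v)) u u) \<ge> 0"
    using assms by (simp add: positive_map_def psd_iff_sesq)
  also have "Re (sesq 4 (tensor_map 2 2 (depol t) (theta a) (outer 4 v)) u u) = 2 * ((1 - t) / 2 - t * a)"
    unfolding sesq_tensor_rank_one by (simp add: sum2 u_def v_def algebra_simps)
  finally show ?thesis by simp
qed

section \<open>Completely positive maps\<close>

lemma sum_lessThan_mult:
  "(\<Sum>r<k * n. f r) = (\<Sum>i<k. \<Sum>p<n. f (i * n + p))" for f :: "nat \<Rightarrow> 'a :: comm_monoid_add"
proof -
  have "(\<Sum>r<k * n. f r) = (\<Sum>i<k. sum f {i * n..<i * n + n})"
    by (simp only: sum.nat_group)
  also have "\<dots> = (\<Sum>i<k. \<Sum>p<n. f (i * n + p))"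
  proof (rule sum.cong[OF refl])
    fix i
    show "sum f {i * n..<i * n + n} = (\<Sum>p<n. f (i * n + p))"
      using sum.shift_bounds_nat_ivl[of f 0 "i * n" n] 
      unfolding add.commute[of n] add.commute[of _ "i * n"] add_0_right atLeast0LessThan .
  qed
  finally show ?thesis .
qed

lemma sum_delta2:
  fixes F :: "nat \<Rightarrow> nat \<Rightarrow> 'a :: comm_monoid_add"
  assumes "i < m" "j < n"
  shows "(\<Sum>a<m. \<Sum>b<n. if i = a \<and> j = b then F a b else 0) = F i j"
proof -
  have "(\<Sum>b<n. if i = a \<and> j = b then F a b else 0) = (if i = a then F a j else 0)" for a
    using assms by (cases "i = a") auto
  then show ?thesis using assms by simp
qed

lemma sum_rotate:
  "(\<Sum>p\<in>A. \<Sum>q\<in>B. \<Sum>m\<in>C. f p q m) = (\<Sum>m\<in>C. \<Sum>p\<in>A. \<Sum>q\<in>B. f p q m)"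
proof -
  have "(\<Sum>p\<in>A. \<Sum>q\<in>B. \<Sum>m\<in>C. f p q m) = (\<Sum>p\<in>A. \<Sum>m\<in>C. \<Sum>q\<in>B. f p q m)"
    by (intro sum.cong refl sum.swap)
  also have "\<dots> = (\<Sum>m\<in>C. \<Sum>p\<in>A. \<Sum>q\<in>B. f p q m)"
    by (rule sum.swap)
  finally show ?thesis .
qed

text \<open>The identity factor contributes Kronecker deltas, so block \<open>(i, j)\<close> of the
  output is the expansion of \<open>\<Phi>\<close> at block \<open>(i, j)\<close> of the
  input.\<close>

lemma tensor_id_entry:
  assumes \<Phi>: "\<And>k l. \<Phi> (munit n k l) \<in> carrier_mat n n"
    and "i < m" "j < m" "p < n" "q < n"
  shows "tensor_map m n (\<lambda>X. X) \<Phi> X $$ (i * n + p, j * n + q)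
    = (\<Sum>k<n. \<Sum>l<n. X $$ (i * n + k, j * n + l) * \<Phi> (munit n k l) $$ (p, q))"
proof -
  have \<Phi>d: "dim_row (\<Phi> (munit n k l)) = n" "dim_col (\<Phi> (munit n k l)) = n" for k l
    using \<Phi>[of k l] by auto
  have "tensor_map m n (\<lambda>X. X) \<Phi> X $$ (i * n + p, j * n + q) =
     (\<Sum>i'<m. \<Sum>j'<m. \<Sum>k<n. \<Sum>l<n. X $$ (i' * n + k, j' * n + l) *
        ((if i = i' \<and> j = j' then 1 else 0) * \<Phi> (munit n k l) $$ (p, q)))"
    using assms(2-) by (simp add: tensor_map_def kron_def \<Phi>d mult_add_less munit_entry)
  also have "\<dots> = (\<Sum>i'<m. \<Sum>j'<m. if i = i' \<and> j = j' then
      (\<Sum>k<n. \<Sum>l<n. X $$ (i' * n + k, j' * n + l) * \<Phi> (munit n k l) $$ (p, q)) else 0)"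
    by (intro sum.cong refl) (simp split: if_split)
  finally show ?thesis
    using sum_delta2[OF assms(2,3)] by simp
qed

text \<open>Kraus form with real weights kept apart from the operators, which avoids square roots of
  the weights.\<close>

definition kraus_map ::
  "nat \<Rightarrow> nat \<Rightarrow> (nat \<Rightarrow> real) \<Rightarrow> (nat \<Rightarrow> nat \<Rightarrow> nat \<Rightarrow> complex) \<Rightarrow> complex mat \<Rightarrow> complex mat" where
  "kraus_map N n c K X = mat n n (\<lambda>(r, s). \<Sum>m<N. of_real (c m) *
     (\<Sum>p<n. \<Sum>q<n. K m r p * X $$ (p, q) * cnj (K m s q)))"

lemma kraus_map_linear: "linear_map_on n (kraus_map N n c K)"
proof -
  define Q where "Q m r s X = (\<Sum>p<n. \<Sum>q<n. K m r p * X $$ (p, q) * cnj (K m s q))"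
    for m r s and X :: "complex mat"
  have K: "kraus_map N n c K X = mat n n (\<lambda>(r, s). \<Sum>m<N. of_real (c m) * Q m r s X)" for X
    by (simp add: kraus_map_def Q_def)
  have Q_smult: "Q m r s (d \<cdot>\<^sub>m X) = d * Q m r s X" if "X \<in> carrier_mat n n" for d X m r s
    using that unfolding Q_def sum_distrib_left by (intro sum.cong refl) (simp add: mult_ac)
  have Q_add: "Q m r s (X + Y) = Q m r s X + Q m r s Y"
    if "X \<in> carrier_mat n n" "Y \<in> carrier_mat n n" for X Y m r s
    using that unfolding Q_def sum.distrib[symmetric]
    by (intro sum.cong refl) (simp add: algebra_simps)
  show ?thesis
    unfolding linear_map_on_def K
  proof (intro conjI ballI allI)
    fix X Y :: "complex mat" and d :: complex
    assume X: "X \<in> carrier_mat n n" and Y: "Y \<in> carrier_mat n n"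
    show "mat n n (\<lambda>(r, s). \<Sum>m<N. of_real (c m) * Q m r s (X + Y)) =
      mat n n (\<lambda>(r, s). \<Sum>m<N. of_real (c m) * Q m r s X) + mat n n (\<lambda>(r, s). \<Sum>m<N. of_real (c m) * Q m r s Y)"
      unfolding Q_add[OF X Y] by (intro eq_matI) (simp_all add: sum.distrib distrib_left)
  next
    fix X :: "complex mat" and d :: complex
    assume X: "X \<in> carrier_mat n n"
    show "mat n n (\<lambda>(r, s). \<Sum>m<N. of_real (c m) * Q m r s (d \<cdot>\<^sub>m X)) =
      d \<cdot>\<^sub>m mat n n (\<lambda>(r, s). \<Sum>m<N. of_real (c m) * Q m r s X)"
      unfolding Q_smult[OF X] by (intro eq_matI) (simp_all add: sum_distrib_left mult_ac)
  qed simp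
qed

lemma kraus_map_munit:
  assumes "r < n" "s < n" "k < n" "l < n"
  shows "kraus_map N n c K (munit n k l) $$ (r, s) = (\<Sum>m<N. of_real (c m) * (K m r k * cnj (K m s l)))"
proof -
  have "(\<Sum>p<n. \<Sum>q<n. K m r p * munit n k l $$ (p, q) * cnj (K m s q))
      = (\<Sum>p<n. \<Sum>q<n. if k = p \<and> l = q then K m r p * cnj (K m s q) else 0)" for m
  proof (intro sum.cong refl)
    fix p q assume "p \<in> {..<n}" "q \<in> {..<n}"
    then have pq: "p < n" "q < n" by auto
    show "K m r p * munit n k l $$ (p, q) * cnj (K m s q)
        = (if k = p \<and> l = q then K m r p * cnj (K m s q) else 0)"
      unfolding munit_entry[OF pq] eq_commute[of p k] eq_commute[of q l] by simp
  qed
  then show ?thesis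
    using assms by (simp add: kraus_map_def sum_delta2)
qed

text \<open>Tensored with the identity, the map sends the rank one matrix of \<open>x\<close> to the
  sum of the rank one matrices of \<open>y m\<close>, weighted by \<open>c m\<close>, where
  \<open>y m\<close> is the image of \<open>x\<close> under 1 \<otimes> \<open>K m\<close>.\<close>

lemma kraus_map_completely_positive:
  assumes c: "\<And>m. m < N \<Longrightarrow> c m \<ge> 0"
  shows "completely_positive n (kraus_map N n c K)"
  unfolding completely_positive_def
proof (intro conjI allI kraus_map_linear positive_map_rank_oneI tensor_map_linear)
  fix k and x :: "nat \<Rightarrow> complex"
  define Y where "Y = tensor_map k n (\<lambda>X. X) (kraus_map N n c K) (outer (k * n) x)"
  define y where "y m r = (\<Sum>p<n. K m (r mod n) p * x (r div n * n + p))" for m r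
  have Y: "Y $$ (r, s) = (\<Sum>m<N. of_real (c m) * outer (k * n) (y m) $$ (r, s))"
    if rs: "r < k * n" "s < k * n" for r s
  proof -
    have n: "n > 0" using rs by (cases n) auto
    then have dm: "r div n < k" "s div n < k" "r mod n < n" "s mod n < n"
      using rs by (auto simp: div_less_iff_less_mult)
    have car: "kraus_map N n c K (munit n p q) \<in> carrier_mat n n" for p q
      by (simp add: kraus_map_def)
    have "Y $$ (r div n * n + r mod n, s div n * n + s mod n) =
      (\<Sum>p<n. \<Sum>q<n. outer (k * n) x $$ (r div n * n + p, s div n * n + q) *
        kraus_map N n c K (munit n p q) $$ (r mod n, s mod n))"
      unfolding Y_def by (rule tensor_id_entry[where \<Phi> = "kraus_map N n c K"]) (use car dm in auto)
    also have "\<dots> = (\<Sum>p<n. \<Sum>q<n. x (r div n * n + p) * cnj (x (s div n * n + q)) *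
        (\<Sum>m<N. of_real (c m) * (K m (r mod n) p * cnj (K m (s mod n) q))))"
      by (intro sum.cong refl) (simp add: kraus_map_munit dm outer_def mult_add_less)
    also have "\<dots> = (\<Sum>p<n. \<Sum>q<n. \<Sum>m<N. of_real (c m) *
        (K m (r mod n) p * x (r div n * n + p) * cnj (K m (s mod n) q * x (s div n * n + q))))"
      by (simp add: sum_distrib_left mult_ac)
    also have "\<dots> = (\<Sum>m<N. \<Sum>p<n. \<Sum>q<n. of_real (c m) *
        (K m (r mod n) p * x (r div n * n + p) * cnj (K m (s mod n) q * x (s div n * n + q))))"
      by (rule sum_rotate)
    also have "\<dots> = (\<Sum>m<N. of_real (c m) * (y m r * cnj (y m s)))"
      unfolding y_def cnj_sum sum_product by (simp add: sum_distrib_left)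
    finally show ?thesis
      using rs by (simp add: outer_def)
  qed
  have "sesq (k * n) Y v v = (\<Sum>i<k * n. \<Sum>j<k * n. \<Sum>m<N. of_real (c m) *
      (cnj (v i) * outer (k * n) (y m) $$ (i, j) * v j))" for v
    unfolding sesq_def by (intro sum.cong refl) (simp add: Y sum_distrib_left sum_distrib_right mult_ac)
  also have "\<dots> v = (\<Sum>m<N. of_real (c m) * sesq (k * n) (outer (k * n) (y m)) v v)" for v
    unfolding sesq_def sum_distrib_left by (rule sum_rotate)
  finally have "sesq (k * n) Y v v
      = of_real (\<Sum>m<N. c m * (cmod (\<Sum>i<k * n. cnj (y m i) * v i))\<^sup>2)" for v
    by (simp add: sesq_outer)
  then have "Im (sesq (k * n) Y v v) = 0 \<and> Re (sesq (k * n) Y v v) \<ge> 0" for v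
    using c by (simp only: Im_complex_of_real Re_complex_of_real) (auto intro!: sum_nonneg)
  then show "psd (k * n) Y"
    by (simp add: psd_iff_sesq) (simp add: Y_def tensor_map_def)
qed

subsection \<open>The decomposable range\<close>

lemma sum5: "(\<Sum>i<5. f i) = f 0 + f 1 + f 2 + f 3 + f 4" for f :: "nat \<Rightarrow> 'a :: comm_monoid_add"
  by (simp add: eval_nat_numeral ac_simps)

text \<open>The operator \<open>g m\<close> \<otimes> 1 on the two qubits.\<close>

definition amplify :: "(nat \<Rightarrow> nat \<Rightarrow> nat \<Rightarrow> real) \<Rightarrow> nat \<Rightarrow> nat \<Rightarrow> nat \<Rightarrow> complex" where
  "amplify g m r p = (if r mod 2 = p mod 2 then of_real (g m (r div 2) (p div 2)) else 0)"

lemma kraus_amplify_entry: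
  assumes "r < 4" "s < 4"
  shows "kraus_map N 4 c (amplify g) X $$ (r, s) = (\<Sum>m<N. of_real (c m) *
    (\<Sum>x<2. \<Sum>y<2. of_real (g m (r div 2) x * g m (s div 2) y) * X $$ (x * 2 + r mod 2, y * 2 + s mod 2)))"
proof -
  have inner: "(\<Sum>p<4. h p * amplify g m r p) = (\<Sum>x<2. h (x * 2 + r mod 2) * of_real (g m (r div 2) x))"
    for h m r
  proof -
    have "(\<Sum>p<2 * 2. h p * amplify g m r p)
        = (\<Sum>x<2. \<Sum>y<2. h (x * 2 + y) * amplify g m r (x * 2 + y))"
      by (rule sum_lessThan_mult)
    also have "\<dots> = (\<Sum>x<2. h (x * 2 + r mod 2) * of_real (g m (r div 2) x))"
    proof (rule sum.cong[OF refl])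
      fix x :: nat
      have "r mod 2 = 0 \<or> r mod 2 = 1" by auto
      then show "(\<Sum>y<2. h (x * 2 + y) * amplify g m r (x * 2 + y))
          = h (x * 2 + r mod 2) * of_real (g m (r div 2) x)"
        by (elim disjE) (simp_all add: sum2 amplify_def)
    qed
    finally show ?thesis by simp
  qed
  have cnj: "cnj (amplify g m r p) = amplify g m r p" for m r p
    by (simp add: amplify_def)
  have "(\<Sum>p<4. \<Sum>q<4. amplify g m r p * X $$ (p, q) * amplify g m s q)
      = (\<Sum>x<2. \<Sum>y<2. of_real (g m (r div 2) x * g m (s div 2) y) * X $$ (x * 2 + r mod 2, y * 2 + s mod 2))"
    for m
  proof -
    have "(\<Sum>p<4. \<Sum>q<4. amplify g m r p * X $$ (p, q) * amplify g m s q)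
        = (\<Sum>p<4. (\<Sum>q<4. X $$ (p, q) * amplify g m s q) * amplify g m r p)"
      unfolding sum_distrib_right by (simp only: mult_ac)
    also have "\<dots> = (\<Sum>x<2. \<Sum>y<2. of_real (g m (r div 2) x * g m (s div 2) y) *
        X $$ (x * 2 + r mod 2, y * 2 + s mod 2))"
      unfolding inner unfolding sum_distrib_right of_real_mult by (simp only: mult_ac)
    finally show ?thesis .
  qed
  then show ?thesis
    using assms by (simp add: kraus_map_def cnj)
qed

text \<open>The two terms of \<theta>_a are treated separately: \<open>T\<close> is (1 - a) T_t
  \<otimes> id, and \<open>S\<close> is a (T_t composed with the transpose) \<otimes> id, so that
  the full transpose of \<open>S\<close> is a T_t \<otimes> transpose.\<close>

lemma tensor_depol_theta_decomposable:
  assumes "0 \<le> t" "t \<le> 1" "0 \<le> a" "a \<le> 1" and range: "t \<le> 1 / 3 \<or> a = 0"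
  shows "decomposable 4 (tensor_map 2 2 (depol t) (theta a))"
proof -
  define g :: "nat \<Rightarrow> nat \<Rightarrow> nat \<Rightarrow> real" where "g m x y =
    (if m = 4 then (if x = y then 1 else 0) else (if x = m div 2 \<and> y = m mod 2 then 1 else 0))" for m x y
  define h :: "nat \<Rightarrow> nat \<Rightarrow> nat \<Rightarrow> real" where "h m x y =
    (if m = 4 then (if x \<noteq> y then 1 else 0) else (if x = m div 2 \<and> y = m mod 2 then 1 else 0))" for m x y
  \<comment> \<open>Kraus weights of T_t: the identity carries \<open>t\<close>, the four matrix
    units carry \<open>(1 - t) / 2\<close> each.\<close>
  define c :: "nat \<Rightarrow> real" where "c m = (1 - a) * (if m = 4 then t else (1 - t) / 2)" for m
  \<comment> \<open>The Choi matrix of T_t after the transpose is \<open>(1 - 3 * t) / 2\<close>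
    times 1 plus \<open>t\<close> times (1 + F), F the swap. The four matrix units realise 1; the
    diagonal units with weight 2 and the flip \<open>h 4\<close> with weight 1 realise 1 +
    F.\<close>
  define d :: "nat \<Rightarrow> real" where "d m = (if m = 4 then a * t
    else if m = 0 \<or> m = 3 then a * (1 - 3 * t) / 2 + 2 * a * t else a * (1 - 3 * t) / 2)" for m
  define T where "T = kraus_map 5 4 c (amplify g)"
  define S where "S = kraus_map 5 4 d (amplify h)"
  have "completely_positive 4 T"
    unfolding T_def by (rule kraus_map_completely_positive) (use assms in \<open>simp add: c_def\<close>)
  moreover have "completely_positive 4 S"
  proof -
    have "0 \<le> a * (1 - 3 * t) / 2" using assms by auto
    then show ?thesis
      unfolding S_def by (intro kraus_map_completely_positive) (use assms in \<open>simp add: d_def\<close>)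
  qed
  moreover have "tensor_map 2 2 (depol t) (theta a) X = T X + transpose_mat (S X)"
    if "X \<in> carrier_mat 4 4" for X
  proof (rule eq_matI)
    fix r s
    assume "r < dim_row (T X + transpose_mat (S X))" "s < dim_col (T X + transpose_mat (S X))"
    then have rs: "r < 4" "s < 4" by (simp_all add: T_def S_def kraus_map_def)
    define i j k l where "i = r div 2" and "j = s div 2" and "k = r mod 2" and "l = s mod 2"
    have "(T X + transpose_mat (S X)) $$ (r, s) = T X $$ (r, s) + S X $$ (s, r)"
      using rs by (simp add: T_def S_def kraus_map_def)
    also have "T X $$ (r, s) = (\<Sum>m<5. of_real (c m) *
        (\<Sum>x<2. \<Sum>y<2. of_real (g m i x * g m j y) * X $$ (x * 2 + k, y * 2 + l)))"
      unfolding T_def kraus_amplify_entry[OF rs] i_def j_def k_def l_def ..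
    also have "S X $$ (s, r) = (\<Sum>m<5. of_real (d m) *
        (\<Sum>x<2. \<Sum>y<2. of_real (h m j x * h m i y) * X $$ (x * 2 + l, y * 2 + k)))"
      unfolding S_def kraus_amplify_entry[OF rs(2,1)] i_def j_def k_def l_def ..
    finally have TS: "(T X + transpose_mat (S X)) $$ (r, s) = (\<Sum>m<5. of_real (c m) *
        (\<Sum>x<2. \<Sum>y<2. of_real (g m i x * g m j y) * X $$ (x * 2 + k, y * 2 + l))) +
      (\<Sum>m<5. of_real (d m) *
        (\<Sum>x<2. \<Sum>y<2. of_real (h m j x * h m i y) * X $$ (x * 2 + l, y * 2 + k)))" .
    have "i = 0 \<or> i = 1" "j = 0 \<or> j = 1" using rs by (auto simp: i_def j_def)
    then show "tensor_map 2 2 (depol t) (theta a) X $$ (r, s) = (T X + transpose_mat (S X)) $$ (r, s)"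
      unfolding TS tensor_depol_theta_entry[OF rs] i_def[symmetric] j_def[symmetric]
        k_def[symmetric] l_def[symmetric]
      by (elim disjE) (simp_all add: sum2 sum5 g_def h_def c_def d_def field_simps)
  qed (simp_all add: T_def S_def kraus_map_def tensor_map_def)
  ultimately show ?thesis
    unfolding decomposable_def by blast
qed

section \<open>A PPT witness against decomposability\<close>

text \<open>Sparse real vectors as lists of coefficient and index, so that forms at explicit test
  vectors expand into short finite sums.\<close>

fun lvec :: "(real \<times> nat) list \<Rightarrow> nat \<Rightarrow> complex" where
  "lvec [] = (\<lambda>_. 0)"
| "lvec (x # L) = (\<lambda>i. lvec L i + of_real (fst x) * (if i = snd x then 1 else 0))"

lemma sesq_lvec:
  assumes "\<And>x. x \<in> set L \<Longrightarrow> snd x < n" "\<And>x. x \<in> set M \<Longrightarrow> snd x < n"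
  shows "sesq n A (lvec L) (lvec M)
    = (\<Sum>x\<leftarrow>L. \<Sum>y\<leftarrow>M. of_real (fst x * fst y) * A $$ (snd x, snd y))"
proof -
  define e where "e k = (\<lambda>i. if i = k then 1 else 0 :: complex)" for k :: nat
  have right: "sesq n A v (lvec M) = (\<Sum>y\<leftarrow>M. of_real (fst y) * sesq n A v (e (snd y)))" for v
    by (induction M) (simp_all add: sesq_combine_right e_def, simp add: sesq_def)
  have left: "sesq n A (lvec L) v = (\<Sum>x\<leftarrow>L. of_real (fst x) * sesq n A (e (snd x)) v)" for v
    by (induction L) (simp_all add: sesq_combine_left e_def, simp add: sesq_def)
  have "of_real (fst x) * (\<Sum>y\<leftarrow>M. of_real (fst y) * sesq n A (e (snd x)) (e (snd y)))
      = (\<Sum>y\<leftarrow>M. of_real (fst x * fst y) * A $$ (snd x, snd y))" if "x \<in> set L" for x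
    unfolding sum_list_const_mult[symmetric] using assms that
    by (intro arg_cong[where f = sum_list] map_cong refl) (simp add: e_def sesq_delta)
  then show ?thesis
    unfolding left unfolding right by (intro arg_cong[where f = sum_list] map_cong refl)
qed

text \<open>The quadratic form of a Choi matrix at a real sparse vector; a list item holds
  coefficient, input index and output index. Taking the entries as a function \<open>\<tau>\<close>
  makes transposition of the output a swap of the last two arguments.\<close>

definition choi_form ::
  "(nat \<Rightarrow> nat \<Rightarrow> nat \<Rightarrow> nat \<Rightarrow> real) \<Rightarrow> (real \<times> nat \<times> nat) list \<Rightarrow> real" where
  "choi_form \<tau> L = (\<Sum>x\<leftarrow>L. \<Sum>y\<leftarrow>L.
     fst x * fst y * \<tau> (fst (snd x)) (fst (snd y)) (snd (snd x)) (snd (snd y)))"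

text \<open>The Choi matrix is the image of the unnormalised maximally entangled projection, given
  by \<open>\<omega>\<close>, under id \<otimes> \<open>\<Phi>\<close>, hence positive semidefinite.
  At a real vector the real part of its form involves only the real parts of the entries.\<close>

lemma completely_positive_choi_form:
  assumes cp: "completely_positive n \<Phi>" and L: "\<forall>x \<in> set L. fst (snd x) < n \<and> snd (snd x) < n"
  shows "0 \<le> choi_form (\<lambda>i j p q. Re (\<Phi> (munit n i j) $$ (p, q))) L"
proof -
  define \<omega> :: "nat \<Rightarrow> complex" where "\<omega> r = (if r div n = r mod n then 1 else 0)" for r
  define Y where "Y = tensor_map n n (\<lambda>X. X) \<Phi> (outer (n * n) \<omega>)"
  define M where "M = map (\<lambda>x. (fst x, fst (snd x) * n + snd (snd x))) L"
  have car: "\<Phi> (munit n k l) \<in> carrier_mat n n" for k l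
    using cp by (simp add: completely_positive_def linear_map_on_def)
  have Y: "Y $$ (i * n + p, j * n + q) = \<Phi> (munit n i j) $$ (p, q)"
    if "i < n" "p < n" "j < n" "q < n" for i p j q
  proof -
    have "Y $$ (i * n + p, j * n + q) = (\<Sum>k<n. \<Sum>l<n.
        outer (n * n) \<omega> $$ (i * n + k, j * n + l) * \<Phi> (munit n k l) $$ (p, q))"
      unfolding Y_def using that by (intro tensor_id_entry car)
    also have "\<dots> = (\<Sum>k<n. \<Sum>l<n. if i = k \<and> j = l then \<Phi> (munit n k l) $$ (p, q) else 0)"
    proof (intro sum.cong refl)
      fix k l assume "k \<in> {..<n}" "l \<in> {..<n}"
      then show "outer (n * n) \<omega> $$ (i * n + k, j * n + l) * \<Phi> (munit n k l) $$ (p, q)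
          = (if i = k \<and> j = l then \<Phi> (munit n k l) $$ (p, q) else 0)"
        using that by (simp add: outer_def mult_add_less \<omega>_def)
    qed
    finally show ?thesis
      using sum_delta2[OF that(1,3)] by simp
  qed
  have "psd (n * n) (outer (n * n) \<omega>)"
    by (simp add: psd_iff_sesq sesq_outer) (simp add: outer_def)
  then have "psd (n * n) Y"
    using cp by (simp add: completely_positive_def positive_map_def Y_def)
  then have "0 \<le> Re (sesq (n * n) Y (lvec M) (lvec M))"
    by (simp add: psd_iff_sesq)
  also have "sesq (n * n) Y (lvec M) (lvec M)
      = (\<Sum>x\<leftarrow>M. \<Sum>y\<leftarrow>M. of_real (fst x * fst y) * Y $$ (snd x, snd y))"
    using L by (intro sesq_lvec) (auto simp: M_def mult_add_less)
  also have "\<dots> = (\<Sum>x\<leftarrow>L. \<Sum>y\<leftarrow>L. of_real (fst x * fst y) *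
      \<Phi> (munit n (fst (snd x)) (fst (snd y))) $$ (snd (snd x), snd (snd y)))"
    unfolding M_def map_map comp_def
    by (intro arg_cong[where f = sum_list] map_cong refl) (use L Y in simp)
  also have "Re \<dots> = choi_form (\<lambda>i j p q. Re (\<Phi> (munit n i j) $$ (p, q))) L"
  proof -
    have Re_sum_list: "Re (\<Sum>x\<leftarrow>K. f x) = (\<Sum>x\<leftarrow>K. Re (f x))"
      for K :: "(real \<times> nat \<times> nat) list" and f
      by (induction K) auto
    show ?thesis
      by (simp add: choi_form_def Re_sum_list)
  qed
  finally show ?thesis .
qed

text \<open>Coordinates: the input index is \<open>2 i + k\<close>, the output index is \<open>2 j + l\<close>; the
  first list is a vector on the pair \<open>(i, j)\<close>, the second one a vector on \<open>(k, l)\<close>.\<close>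
definition ten :: "(real \<times> nat \<times> nat) list \<Rightarrow> (real \<times> nat \<times> nat) list \<Rightarrow> (real \<times> nat \<times> nat) list"
  where "ten \<alpha> \<beta> = concat (map (\<lambda>x. map (\<lambda>y.
    (fst x * fst y, 2 * fst (snd x) + fst (snd y), 2 * snd (snd x) + snd (snd y))) \<beta>) \<alpha>)"

definition "e00 = [(1 :: real, 0 :: nat, 0 :: nat)]"
definition "e11 = [(1 :: real, 1 :: nat, 1 :: nat)]"
definition "e01 = [(1 :: real, 0 :: nat, 1 :: nat)]"
definition "e10 = [(1 :: real, 1 :: nat, 0 :: nat)]"
definition "bell_p = [(1 :: real, 0 :: nat, 0 :: nat), (1, 1, 1)]"
definition "bell_z = [(1 :: real, 0 :: nat, 0 :: nat), (-1, 1, 1)]"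
definition "bell_s = [(1 :: real, 0 :: nat, 1 :: nat), (1, 1, 0)]"
definition "bell_a = [(1 :: real, 0 :: nat, 1 :: nat), (-1, 1, 0)]"

lemmas vec_defs = e00_def e11_def e01_def e10_def bell_p_def bell_z_def bell_s_def bell_a_def

text \<open>Choi pairings with 4 times the witness and 4 times its partial transpose; a weight
  accounts for the normalisation of the projections.\<close>
definition witness :: "(nat \<Rightarrow> nat \<Rightarrow> nat \<Rightarrow> nat \<Rightarrow> real) \<Rightarrow> real" where
  "witness \<tau> = 3 * choi_form \<tau> (ten bell_p bell_a)
    + 4 * choi_form \<tau> (ten e01 bell_z) + 4 * choi_form \<tau> (ten e01 bell_s) + 2 * choi_form \<tau> (ten e01 bell_a)
    + 4 * choi_form \<tau> (ten e10 bell_z) + 4 * choi_form \<tau> (ten e10 bell_s) + 2 * choi_form \<tau> (ten e10 bell_a)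
    + 2 * choi_form \<tau> (ten bell_z bell_z) + 2 * choi_form \<tau> (ten bell_z bell_s)
    + choi_form \<tau> (ten bell_z bell_a)"

definition witness_pt :: "(nat \<Rightarrow> nat \<Rightarrow> nat \<Rightarrow> nat \<Rightarrow> real) \<Rightarrow> real" where
  "witness_pt \<tau> =
      2 * choi_form \<tau> (ten e00 bell_z) + 2 * choi_form \<tau> (ten e00 bell_s) + 4 * choi_form \<tau> (ten e00 bell_a)
    + 2 * choi_form \<tau> (ten e11 bell_z) + 2 * choi_form \<tau> (ten e11 bell_s) + 4 * choi_form \<tau> (ten e11 bell_a)
    + choi_form \<tau> (ten bell_s bell_z) + choi_form \<tau> (ten bell_s bell_s)
    + 2 * choi_form \<tau> (ten bell_s bell_a)
    + 3 * choi_form \<tau> (ten bell_a bell_p) + 3 * choi_form \<tau> (ten bell_a bell_a)"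

text \<open>Transposing the output of a map is moved onto the witness as its partial transpose. Both
  sides are the same linear form in the values of \<open>\<sigma>\<close>.\<close>

lemma witness_partial_transpose:
  "witness (\<lambda>i j p q. \<sigma> i j q p) = witness_pt \<sigma>"
  unfolding witness_def witness_pt_def choi_form_def ten_def vec_defs
  by (simp add: algebra_simps eval_nat_numeral)

lemma witness_add:
  "witness (\<lambda>i j p q. \<tau> i j p q + \<sigma> i j p q) = witness \<tau> + witness \<sigma>"
proof -
  have "choi_form (\<lambda>i j p q. \<tau> i j p q + \<sigma> i j p q) L = choi_form \<tau> L + choi_form \<sigma> L" for L
    by (simp add: choi_form_def distrib_left sum_list_addf)
  then show ?thesis by (simp add: witness_def)
qed

text \<open>The second factor of the witness is orthogonal to \<open>p\<close>, so of the Choi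
  matrix of \<theta>_a only \<open>a\<close> times the swap is seen: it gives \<open>- a\<close> on
  \<open>m\<close> and \<open>3 * a\<close> on 2 s + m. The Choi matrix of T_t has trace
  \<open>(1 + 3 * t) / 2\<close> against \<open>p\<close> and \<open>3 * (1 - t) / 2\<close> against
  1 - p. The normalisation contributes the factor 4.\<close>

lemma witness_depol_theta:
  "witness (\<lambda>i j p q. Re (tensor_map 2 2 (depol t) (theta a) (munit 4 i j) $$ (p, q)))
    = 12 * a * (1 - 3 * t)"
  unfolding witness_def choi_form_def ten_def vec_defs
  by (simp add: tensor_depol_theta_entry munit_entry sum2 field_simps)

text \<open>A completely positive \<open>T\<close> pairs nonnegatively with the witness, and the
  transpose of \<open>S\<close> does so through the partial transpose, whereas the pairing with the
  whole map is negative for these parameters.\<close>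

lemma tensor_depol_theta_not_decomposable:
  assumes "1 / 3 < t" "0 < a"
  shows "\<not> decomposable 4 (tensor_map 2 2 (depol t) (theta a))"
proof
  let ?\<Phi> = "tensor_map 2 2 (depol t) (theta a)"
  assume "decomposable 4 ?\<Phi>"
  then obtain T S where T: "completely_positive 4 T" and S: "completely_positive 4 S"
    and \<Phi>: "\<And>X. X \<in> carrier_mat 4 4 \<Longrightarrow> ?\<Phi> X = T X + transpose_mat (S X)"
    unfolding decomposable_def by blast
  define \<tau> where "\<tau> i j p q = Re (T (munit 4 i j) $$ (p, q))" for i j p q
  define \<sigma> where "\<sigma> i j p q = Re (S (munit 4 i j) $$ (p, q))" for i j p q
  have car: "S (munit 4 i j) \<in> carrier_mat 4 4" for i j
    using S by (simp add: completely_positive_def linear_map_on_def)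
  have split: "Re (?\<Phi> (munit 4 i j) $$ (p, q)) = \<tau> i j p q + \<sigma> i j q p" if "p < 4" "q < 4" for i j p q
    using that car[of i j] by (simp add: \<Phi> \<tau>_def \<sigma>_def)
  \<comment> \<open>The splitting of the entries is known only for output indices below 4; the test
    vectors read no others.\<close>
  have cong: "choi_form f (ten \<alpha> \<beta>) = choi_form g (ten \<alpha> \<beta>)"
    if fg: "\<And>i j p q. p < 4 \<Longrightarrow> q < 4 \<Longrightarrow> f i j p q = g i j p q"
      and "\<forall>x \<in> set (ten \<alpha> \<beta>). snd (snd x) < 4" for f g \<alpha> \<beta>
    unfolding choi_form_def using that
    by (intro arg_cong[where f = sum_list] map_cong refl) simp
  have "12 * a * (1 - 3 * t) = witness (\<lambda>i j p q. Re (?\<Phi> (munit 4 i j) $$ (p, q)))"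
    by (rule witness_depol_theta[symmetric])
  also have "\<dots> = witness (\<lambda>i j p q. \<tau> i j p q + \<sigma> i j q p)"
    unfolding witness_def
    by (intro arg_cong2[where f = "(+)"] arg_cong2[where f = "(*)"] refl cong split)
      (simp_all add: ten_def vec_defs)
  also have "\<dots> = witness \<tau> + witness_pt \<sigma>"
    by (simp only: witness_add witness_partial_transpose)
  \<comment> \<open>All weights in \<open>witness\<close> and \<open>witness_pt\<close> are
    nonnegative, so each summand is a nonnegative multiple of a Choi form.\<close>
  also have "\<dots> \<ge> 0"
  proof -
    have T_nonneg: "0 \<le> choi_form \<tau> L" if "\<forall>x \<in> set L. fst (snd x) < 4 \<and> snd (snd x) < 4" for L
      unfolding \<tau>_def using completely_positive_choi_form[OF T that] .
    have S_nonneg: "0 \<le> choi_form \<sigma> L" if "\<forall>x \<in> set L. fst (snd x) < 4 \<and> snd (snd x) < 4" for L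
      unfolding \<sigma>_def using completely_positive_choi_form[OF S that] .
    show ?thesis
      unfolding witness_def witness_pt_def
      by (intro add_nonneg_nonneg mult_nonneg_nonneg T_nonneg S_nonneg) (simp_all add: ten_def vec_defs)
  qed
  finally have "0 \<le> a * (1 - 3 * t)" by simp
  then show False using assms by (simp add: zero_le_mult_iff)
qed

section \<open>Intersection of the positivity range with the complement of the decomposable
  range\<close>

theorem mainTheorem17:
  fixes t a :: real
  assumes "0 \<le> t" "t \<le> 1" "0 \<le> a" "a \<le> 1"
  shows "(positive_map 4 (tensor_map 2 2 (depol t) (theta a)) \<and>
          \<not> decomposable 4 (tensor_map 2 2 (depol t) (theta a)))
         \<longleftrightarrow> (1/3 < t \<and> t \<le> 1 / (2 * a + 1) \<and> 0 < a)"
proof -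
  \<comment> \<open>The condition found by the test vectors, multiplied out;
    \<open>2 * a + 1\<close> is positive.\<close>
  have bound: "t * a \<le> (1 - t) / 2 \<longleftrightarrow> t \<le> 1 / (2 * a + 1)"
    using assms by (simp add: field_simps)
  have positive: "positive_map 4 (tensor_map 2 2 (depol t) (theta a)) \<longleftrightarrow> t \<le> 1 / (2 * a + 1)"
    using positive_imp_bound tensor_depol_theta_positive[OF assms(1,3,4)] bound by blast
  have "decomposable 4 (tensor_map 2 2 (depol t) (theta a)) \<longleftrightarrow> t \<le> 1 / 3 \<or> a = 0"
    using tensor_depol_theta_decomposable[OF assms] tensor_depol_theta_not_decomposable[of t a] assms
    by (cases "t \<le> 1 / 3 \<or> a = 0") auto
  with positive show ?thesis
    using assms by auto
qed

end
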